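(* Let $(S,d)$ be a compact metric space, let $\theta\in\mathcal P(S)$, and let $1\le j\le k$ with $k\ge 2$ be integers. Then the Markov chain $\mathbf X^{\theta,j,k}=(X^{\theta,j,k}(t),\ t=0,1,2,\ldots)$ on $S$ has a unique stationary distribution, denoted $\pi_{j,k}(\theta)$. From any initial point, the variation distance $D(t)$ between $\pi_{j,k}(\theta)$ and the distribution of $X^{\theta,j,k}(t)$ satisfies $$D(2t)\le \left(1-\frac{1}{k^{k-1}}\right)^t,\qquad 1\le t<\infty \ (t \text{ an integer}),$$ and so there is convergence to stationarity in variation distance. Moreover, $\pi=\pi_{j,k}(\theta)$ satisfies $$(\theta(A))^k\le \pi(A)\le k\,\theta(A)\qquad\text{for all (measurable) } A\subseteq S,$$ and so $\pi$ and $\theta$ are mutually absolutely continuous.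
   Context: $\mathcal P(S)$ is the set of Borel probability measures on the compact metric space $(S,d)$. Given $\theta\in\mathcal P(S)$ and integers $k\ge 2$, $1\le j\le k$, the chain $\mathbf X^{\theta,j,k}$ is the discrete-time Markov chain on $S$ with the following transition: from the current state $s$, draw $k$ independent samples $Y_1,\dots,Y_k$ from $\theta$ (independently of the past) and jump to the $j$'th nearest of these to $s$, i.e. order $Y_1,\dots,Y_k$ by increasing distance $d(s,Y_i)$, breaking ties uniformly at random, and move to the $j$'th in the order. (Since the $Y_i$ are i.i.d., breaking ties in favour of the smaller index gives the same transition kernel.) The variation distance between probability measures $\mu,\nu$ on $S$ is $\sup_A|\mu(A)-\nu(A)|$, the supremum being over Borel sets $A\subseteq S$. *)

theory Defs
  imports "HOL-Probability.Probability"
begin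

text \<open>
  The rank (counted from 1) of the sample \<open>Y i\<close> when \<open>Y 0, ..., Y (k - 1)\<close> are ordered by
  increasing distance from \<open>s\<close>, samples at equal distance being ordered by the priorities \<open>\<sigma>\<close>.
\<close>
definition dist_rank ::
  "nat \<Rightarrow> 'a::metric_space \<Rightarrow> (nat \<Rightarrow> 'a) \<Rightarrow> (nat \<Rightarrow> nat) \<Rightarrow> nat \<Rightarrow> nat" where
  "dist_rank k s Y \<sigma> i =
     card {l. l < k \<and> (dist s (Y l) < dist s (Y i) \<or>
                       dist s (Y l) = dist s (Y i) \<and> \<sigma> l \<le> \<sigma> i)}"

text \<open>
  The index is unique for \<open>1 \<le> j \<le> k\<close> and \<open>\<sigma>\<close> injective on \<open>{..<k}\<close>.
\<close>
definition jth_nearest ::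
  "nat \<Rightarrow> nat \<Rightarrow> 'a::metric_space \<Rightarrow> (nat \<Rightarrow> 'a) \<Rightarrow> (nat \<Rightarrow> nat) \<Rightarrow> 'a" where
  "jth_nearest j k s Y \<sigma> = Y (THE i. i < k \<and> dist_rank k s Y \<sigma> i = j)"

text \<open>
  The transition kernel: \<open>k\<close> i.i.d. samples from \<open>\<theta>\<close> and an independent uniformly random
  permutation of the indices, which breaks the ties uniformly at random.
\<close>
definition nearest_kernel ::
  "'a::metric_space measure \<Rightarrow> nat \<Rightarrow> nat \<Rightarrow> 'a \<Rightarrow> 'a measure" where
  "nearest_kernel \<theta> j k s =
     distr ((\<Pi>\<^sub>M i\<in>{..<k}. \<theta>) \<Otimes>\<^sub>M uniform_count_measure {\<sigma>. \<sigma> permutes {..<k}}) borel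
       (\<lambda>(Y, \<sigma>). jth_nearest j k s Y \<sigma>)"

text \<open>
  The distribution at time \<open>t\<close> of the chain with this kernel started at the point \<open>x\<close>.
\<close>
primrec chain_law ::
  "'a::metric_space measure \<Rightarrow> nat \<Rightarrow> nat \<Rightarrow> 'a \<Rightarrow> nat \<Rightarrow> 'a measure" where
  "chain_law \<theta> j k x 0 = return borel x"
| "chain_law \<theta> j k x (Suc t) = chain_law \<theta> j k x t \<bind> nearest_kernel \<theta> j k"

definition stationary_distribution ::
  "'a::metric_space measure \<Rightarrow> nat \<Rightarrow> nat \<Rightarrow> 'a measure \<Rightarrow> bool" where
  "stationary_distribution \<theta> j k \<pi> \<longleftrightarrow>
     prob_space \<pi> \<and> sets \<pi> = sets borel \<and> \<pi> \<bind> nearest_kernel \<theta> j k = \<pi>"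

definition variation_distance ::
  "'a::topological_space measure \<Rightarrow> 'a measure \<Rightarrow> real" where
  "variation_distance \<mu> \<nu> = (SUP A\<in>sets borel. \<bar>measure \<mu> A - measure \<nu> A\<bar>)"

end

theory Submission
  imports Defs
begin

text \<open>
  The chain forgets its starting point because any two of its transition laws, from \<open>s\<close> and from
  \<open>s'\<close>, share the mass \<open>c = 1 / ((2 * k - 1) choose k)\<close> (\<open>kernel_overlap\<close>). To see this, let both
  transitions use a common pool of \<open>2 * k - 1\<close> independent samples from \<open>\<theta>\<close> and let each chain pick
  a random \<open>k\<close>-subset of the pool, which is again a vector of \<open>k\<close> independent samples, and move to
  the \<open>j\<close>'th nearest point of it. From \<open>s\<close>, a pool point can be chosen by some \<open>k\<close>-subset as soon as
  at least \<open>j - 1\<close> pool points come before it and at least \<open>k - j\<close> after it, which fails for only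
  \<open>k - 1\<close> points of the pool. As \<open>2 * (k - 1) < 2 * k - 1\<close>, every pool contains a point that can be
  chosen both from \<open>s\<close> and from \<open>s'\<close>, and each chain chooses it with probability at least \<open>c\<close>. The
  argument is purely combinatorial, so atoms of \<open>\<theta>\<close> and ties cause no difficulty once random tie
  breaking has been replaced by tie breaking by index (\<open>nearest_kernel_eq\<close>).

  Overlap \<open>c\<close> makes the oscillation of \<open>x \<mapsto> P(X(t) \<in> A | X(0) = x)\<close> shrink by the factor \<open>1 - c\<close> in
  every step (\<open>law_oscillation\<close>). Hence the laws at time \<open>t\<close> form a Cauchy sequence, uniformly over
  measurable sets; the limit is a stationary distribution (\<open>ex_stationary\<close>), it is the only one, and
  the variation distance to it at time \<open>t\<close> is at most \<open>(1 - c) ^ t\<close>. The stated rate is then the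
  inequality \<open>(1 - c)\<^sup>2 \<le> 1 - 1 / k ^ (k - 1)\<close> (\<open>two_step_rate_le\<close>).

  The bounds on the stationary distribution hold already for each single transition: the chain lands
  in \<open>A\<close> if all samples do, and only if at least one does. Stationarity averages these bounds.
\<close>

section \<open>Integrals against close or overlapping measures\<close>

lemma integral_mono_measure_le:
  fixes f :: "'a \<Rightarrow> real"
  assumes sets: "sets \<eta> = sets M" "sets \<mu> = sets M" and le: "\<eta> \<le> \<mu>"
    and f: "f \<in> borel_measurable M" "integrable \<mu> f" "\<And>x. x \<in> space M \<Longrightarrow> 0 \<le> f x"
  shows "integrable \<eta> f \<and> integral\<^sup>L \<eta> f \<le> integral\<^sup>L \<mu> f"
proof -
  have sp: "space \<eta> = space M" "space \<mu> = space M"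
    using sets by (auto dest: sets_eq_imp_space_eq)
  have m: "f \<in> borel_measurable \<eta>" "f \<in> borel_measurable \<mu>"
    using f(1) sets by (auto cong: measurable_cong_sets)
  have "(\<integral>\<^sup>+x. ennreal (f x) \<partial>\<eta>) \<le> (\<integral>\<^sup>+x. ennreal (f x) \<partial>\<mu>)"
    using sets le by (intro nn_integral_mono_measure) auto
  also have eq: "\<dots> = ennreal (integral\<^sup>L \<mu> f)"
    using f sp by (intro nn_integral_eq_integral) auto
  finally have le': "(\<integral>\<^sup>+x. ennreal (f x) \<partial>\<eta>) \<le> ennreal (integral\<^sup>L \<mu> f)" .
  have int: "integrable \<eta> f"
    using f sp m le' by (intro integrableI_nonneg) (auto intro: le_less_trans)
  have "ennreal (integral\<^sup>L \<eta> f) \<le> ennreal (integral\<^sup>L \<mu> f)"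
    using le' nn_integral_eq_integral[OF int] f(3) sp(1) by (metis AE_I2)
  moreover have "0 \<le> integral\<^sup>L \<mu> f" using f sp by (intro integral_nonneg_AE) auto
  ultimately show ?thesis using int by (simp add: ennreal_le_iff)
qed

text \<open>
  The mass of \<open>\<eta>\<close> contributes equally to both integrals and cancels. What remains of each measure
  has mass at most \<open>1 - c\<close>, and moving mass from one place to another changes the integral of \<open>g\<close>
  by at most \<open>d\<close> per unit. The cancellation is carried out without subtracting measures: with
  \<open>a \<le> g \<le> b\<close>, the nonnegative functions \<open>b - g\<close> and \<open>g - a\<close> have smaller integrals under \<open>\<eta>\<close>
  than under \<open>\<mu>\<close> and \<open>\<nu>\<close>.
\<close>
lemma integral_diff_le_of_overlap:
  fixes g :: "'a \<Rightarrow> real"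
  assumes \<mu>: "\<mu> \<in> space (prob_algebra M)" and \<nu>: "\<nu> \<in> space (prob_algebra M)"
    and \<eta>: "sets \<eta> = sets M" "\<eta> \<le> \<mu>" "\<eta> \<le> \<nu>" "c \<le> measure \<eta> (space M)"
    and g: "g \<in> borel_measurable M"
    and osc: "\<And>x y. x \<in> space M \<Longrightarrow> y \<in> space M \<Longrightarrow> g x - g y \<le> d"
  shows "(\<integral>x. g x \<partial>\<mu>) - (\<integral>x. g x \<partial>\<nu>) \<le> (1 - c) * d"
proof -
  interpret \<mu>: prob_space \<mu> using \<mu> by (simp add: space_prob_algebra)
  interpret \<nu>: prob_space \<nu> using \<nu> by (simp add: space_prob_algebra)
  have s: "sets \<mu> = sets M" "sets \<nu> = sets M" using \<mu> \<nu> by (auto simp: space_prob_algebra)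
  have sp: "space \<eta> = space M" "space \<mu> = space M" "space \<nu> = space M"
    using s \<eta> by (auto dest: sets_eq_imp_space_eq)
  have ne: "space M \<noteq> {}" using \<mu>.not_empty sp by simp
  then obtain x0 where x0: "x0 \<in> space M" by auto
  have lbd: "g x0 - d \<le> g x" and ubd: "g x \<le> g x0 + d" if "x \<in> space M" for x
    using osc[OF x0 that] osc[OF that x0] by auto
  define a where "a = (INF x\<in>space M. g x)"
  define b where "b = (SUP x\<in>space M. g x)"
  have ag: "a \<le> g x" if "x \<in> space M" for x
    unfolding a_def using that lbd by (intro cINF_lower) (auto intro!: bdd_belowI)
  have gb: "g x \<le> b" if "x \<in> space M" for x
    unfolding b_def using that ubd by (intro cSUP_upper) (auto intro!: bdd_aboveI)
  have "g x - d \<le> a" if "x \<in> space M" for x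
    unfolding a_def using ne osc[OF that] by (intro cINF_greatest) (auto simp: algebra_simps)
  then have "b \<le> a + d"
    unfolding b_def using ne by (intro cSUP_least) (auto simp: algebra_simps)
  have gm: "g \<in> borel_measurable \<mu>" "g \<in> borel_measurable \<nu>"
    using g s by (auto cong: measurable_cong_sets)
  have bd: "AE x in \<mu>. norm (g x) \<le> \<bar>a\<bar> + \<bar>b\<bar>" "AE x in \<nu>. norm (g x) \<le> \<bar>a\<bar> + \<bar>b\<bar>"
    using ag gb sp by (auto intro!: AE_I2 simp: abs_le_iff) force+
  have i\<mu>: "integrable \<mu> g" and i\<nu>: "integrable \<nu> g"
    using \<mu>.integrable_const_bound[OF bd(1) gm(1)] \<nu>.integrable_const_bound[OF bd(2) gm(2)] by auto
  have "emeasure \<eta> (space M) \<le> emeasure \<mu> (space M)"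
    using \<eta> s by (auto simp: le_measure)
  then have fin: "emeasure \<eta> (space \<eta>) \<noteq> \<infinity>"
    using \<mu>.emeasure_space_1 sp by (auto simp: top_unique)
  then interpret \<eta>: finite_measure \<eta> by (intro finite_measureI) auto
  have 1: "integrable \<eta> (\<lambda>x. b - g x) \<and> (\<integral>x. b - g x \<partial>\<eta>) \<le> (\<integral>x. b - g x \<partial>\<mu>)"
    using g gb i\<mu> s \<eta> by (intro integral_mono_measure_le[where M=M]) auto
  have 2: "integrable \<eta> (\<lambda>x. g x - a) \<and> (\<integral>x. g x - a \<partial>\<eta>) \<le> (\<integral>x. g x - a \<partial>\<nu>)"
    using g ag i\<nu> s \<eta> by (intro integral_mono_measure_le[where M=M]) auto
  have "(\<integral>x. g x \<partial>\<mu>) - (\<integral>x. g x \<partial>\<nu>) = b - a - (\<integral>x. b - g x \<partial>\<mu>) - (\<integral>x. g x - a \<partial>\<nu>)"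
    using i\<mu> i\<nu> by (simp add: \<mu>.prob_space \<nu>.prob_space)
  also have "\<dots> \<le> b - a - ((\<integral>x. b - g x \<partial>\<eta>) + (\<integral>x. g x - a \<partial>\<eta>))"
    using 1 2 by simp
  also have "(\<integral>x. b - g x \<partial>\<eta>) + (\<integral>x. g x - a \<partial>\<eta>) = (\<integral>x. b - a \<partial>\<eta>)"
    using 1 2 by (subst Bochner_Integration.integral_add[symmetric]) auto
  also have "\<dots> = measure \<eta> (space M) * (b - a)" using sp by simp
  also have "b - a - measure \<eta> (space M) * (b - a) = (1 - measure \<eta> (space M)) * (b - a)"
    by (simp add: algebra_simps)
  also have "\<dots> \<le> (1 - c) * (b - a)"
    using \<eta>(4) ag[OF x0] gb[OF x0] by (intro mult_right_mono) auto
  also have "\<dots> \<le> (1 - c) * d"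
  proof (intro mult_left_mono)
    have "measure \<eta> (space M) \<le> measure \<mu> (space M)"
      using \<open>emeasure \<eta> (space M) \<le> emeasure \<mu> (space M)\<close> sp
      by (simp add: \<eta>.emeasure_eq_measure \<mu>.emeasure_eq_measure)
    moreover have "measure \<mu> (space M) = 1" using \<mu>.prob_space sp(2) by simp
    ultimately show "0 \<le> 1 - c" using \<eta>(4) by simp
  qed (use \<open>b \<le> a + d\<close> in auto)
  finally show ?thesis .
qed

text \<open>
  The null measure is a common part of any two measures.
\<close>
lemma integral_diff_le_oscillation:
  fixes g :: "'a \<Rightarrow> real"
  assumes "\<mu> \<in> space (prob_algebra M)" "\<nu> \<in> space (prob_algebra M)"
    and "g \<in> borel_measurable M"
    and "\<And>x y. x \<in> space M \<Longrightarrow> y \<in> space M \<Longrightarrow> g x - g y \<le> d"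
  shows "\<bar>(\<integral>x. g x \<partial>\<mu>) - (\<integral>x. g x \<partial>\<nu>)\<bar> \<le> d"
proof -
  have s: "sets \<mu> = sets M" "sets \<nu> = sets M" "space \<mu> = space M" "space \<nu> = space M"
    using assms by (auto simp: space_prob_algebra dest: sets_eq_imp_space_eq)
  have n: "null_measure M \<le> \<mu>" "null_measure M \<le> \<nu>"
    using s by (auto simp: le_measure)
  show ?thesis
    using integral_diff_le_of_overlap[OF assms(1,2) _ n, of 0 g d]
      integral_diff_le_of_overlap[OF assms(2,1) _ n(2,1), of 0 g d] assms by auto
qed

text \<open>
  Up to an error of \<open>1 / n\<close>, a function with values in the unit interval is the average of the
  indicators of its superlevel sets at the levels \<open>1 / n, ..., n / n\<close>, and on each of these sets
  the measures differ by at most \<open>\<epsilon>\<close>.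
\<close>
lemma integral_diff_le_of_setwise:
  fixes g :: "'a \<Rightarrow> real"
  assumes \<mu>: "\<mu> \<in> space (prob_algebra M)" and \<nu>: "\<nu> \<in> space (prob_algebra M)"
    and close: "\<And>A. A \<in> sets M \<Longrightarrow> measure \<mu> A - measure \<nu> A \<le> \<epsilon>"
    and g[measurable]: "g \<in> borel_measurable M"
    and g01: "\<And>x. x \<in> space M \<Longrightarrow> 0 \<le> g x \<and> g x \<le> 1"
  shows "(\<integral>x. g x \<partial>\<mu>) - (\<integral>x. g x \<partial>\<nu>) \<le> \<epsilon>"
proof (rule field_le_epsilon)
  fix e :: real assume "0 < e"
  then obtain n :: nat where n: "n > 0" "1 / n < e"
    using real_arch_inverse[of e] by (auto simp: inverse_eq_divide)
  define B where "B i = {x \<in> space M. real i \<le> n * g x}" for i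
  have B[measurable]: "B i \<in> sets M" for i unfolding B_def by measurable
  define h where "h x = (\<Sum>i\<in>{1..n}. indicator (B i) x :: real)" for x
  \<comment> \<open>\<open>h x\<close> is the integer part of \<open>n * g x\<close>.\<close>
  have h: "n * g x - 1 \<le> h x \<and> h x \<le> n * g x" if x: "x \<in> space M" for x
  proof -
    have "{i \<in> {1..n}. x \<in> B i} = {1..nat \<lfloor>n * g x\<rfloor>}"
    proof -
      have "n * g x \<le> n" using mult_left_mono[of "g x" 1 "real n"] g01[OF x] by simp
      then show ?thesis unfolding B_def using x g01[OF x] by (auto simp: le_nat_iff le_floor_iff; linarith)
    qed
    then have "h x = real (nat \<lfloor>n * g x\<rfloor>)"
      unfolding h_def by (simp add: indicator_def sum.If_cases Int_def)
    then show ?thesis using g01[OF x] by (auto; linarith?)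
  qed
  have *: "integrable \<rho> g" "(\<integral>x. h x \<partial>\<rho>) = (\<Sum>i\<in>{1..n}. measure \<rho> (B i))"
    "n * (\<integral>x. g x \<partial>\<rho>) - 1 \<le> (\<integral>x. h x \<partial>\<rho>)" "(\<integral>x. h x \<partial>\<rho>) \<le> n * (\<integral>x. g x \<partial>\<rho>)"
    if "\<rho> \<in> space (prob_algebra M)" for \<rho>
  proof -
    interpret prob_space \<rho> using that by (simp add: space_prob_algebra)
    have s[measurable_cong]: "sets \<rho> = sets M" using that by (simp add: space_prob_algebra)
    have sp: "space \<rho> = space M" using s by (rule sets_eq_imp_space_eq)
    show ig: "integrable \<rho> g"
      by (rule integrable_const_bound[of _ 1]) (use g01 sp in \<open>auto intro!: AE_I2\<close>)
    have ih: "integrable \<rho> h" unfolding h_def by (auto simp: emeasure_eq_measure)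
    show "(\<integral>x. h x \<partial>\<rho>) = (\<Sum>i\<in>{1..n}. measure \<rho> (B i))"
      unfolding h_def by (simp add: emeasure_eq_measure s)
    have "(\<integral>x. n * g x - 1 \<partial>\<rho>) \<le> (\<integral>x. h x \<partial>\<rho>)"
      using ig ih h sp by (intro integral_mono) auto
    then show "n * (\<integral>x. g x \<partial>\<rho>) - 1 \<le> (\<integral>x. h x \<partial>\<rho>)"
      using ig by (simp add: prob_space)
    have "(\<integral>x. h x \<partial>\<rho>) \<le> (\<integral>x. n * g x \<partial>\<rho>)"
      using ig ih h sp by (intro integral_mono) auto
    then show "(\<integral>x. h x \<partial>\<rho>) \<le> n * (\<integral>x. g x \<partial>\<rho>)" by simp
  qed
  have "(\<Sum>i\<in>{1..n}. measure \<mu> (B i)) \<le> (\<Sum>i\<in>{1..n}. measure \<nu> (B i) + \<epsilon>)"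
    using close B by (intro sum_mono) (auto simp: algebra_simps)
  then have "n * (\<integral>x. g x \<partial>\<mu>) \<le> n * (\<integral>x. g x \<partial>\<nu>) + n * \<epsilon> + 1"
    using *[OF \<mu>] *[OF \<nu>] by (simp add: sum.distrib)
  also have "\<dots> = n * ((\<integral>x. g x \<partial>\<nu>) + \<epsilon> + 1 / n)" using n by (simp add: field_simps)
  finally have "(\<integral>x. g x \<partial>\<mu>) \<le> (\<integral>x. g x \<partial>\<nu>) + \<epsilon> + 1 / n"
    using n by simp
  then show "(\<integral>x. g x \<partial>\<mu>) - (\<integral>x. g x \<partial>\<nu>) \<le> \<epsilon> + e" using n by simp
qed

section \<open>Geometric ergodicity of kernels with pairwise overlap\<close>

text \<open>
  A pairwise form of Doeblin's condition: the shared part may depend on the two starting points,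
  whereas a minorization would ask for a single measure below all transition laws. Pools of samples
  provide the pairwise form directly.
\<close>
locale overlapping_kernel =
  fixes M :: "'a measure" and K :: "'a \<Rightarrow> 'a measure" and c :: real
  assumes kernel[measurable]: "K \<in> M \<rightarrow>\<^sub>M prob_algebra M"
    and not_empty: "space M \<noteq> {}"
    and c: "0 < c" "c \<le> 1"
    and overlap: "\<And>x y. x \<in> space M \<Longrightarrow> y \<in> space M \<Longrightarrow>
      \<exists>\<eta>. sets \<eta> = sets M \<and> \<eta> \<le> K x \<and> \<eta> \<le> K y \<and> c \<le> measure \<eta> (space M)"
begin

definition law :: "nat \<Rightarrow> 'a \<Rightarrow> 'a measure" where
  "law t x = ((\<lambda>\<mu>. \<mu> \<bind> K) ^^ t) (return M x)"

lemma law_0: "law 0 x = return M x" and law_Suc: "law (Suc t) x = law t x \<bind> K"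
  by (simp_all add: law_def)

lemma measurable_law[measurable]: "law t \<in> M \<rightarrow>\<^sub>M prob_algebra M"
proof (induction t)
  case 0
  show ?case unfolding law_def by simp
next
  case (Suc t)
  note Suc[measurable]
  show ?case unfolding law_Suc by measurable
qed

lemma law_in: "x \<in> space M \<Longrightarrow> law t x \<in> space (prob_algebra M)"
  by (rule measurable_space[OF measurable_law])

lemma measure_bind_law:
  assumes "\<mu> \<in> space (prob_algebra M)" "A \<in> sets M"
  shows "measure (\<mu> \<bind> law t) A = (\<integral>x. measure (law t x) A \<partial>\<mu>)"
proof -
  interpret prob_space \<mu> using assms by (simp add: space_prob_algebra)
  have [measurable_cong]: "sets \<mu> = sets M" using assms by (simp add: space_prob_algebra)
  show ?thesis using assms(2)
    by (intro measure_bind[where N=M]) (auto intro!: measurable_prob_algebraD)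
qed

lemma bind_law_Suc:
  assumes "\<mu> \<in> space (prob_algebra M)"
  shows "\<mu> \<bind> law (Suc t) = (\<mu> \<bind> law t) \<bind> K"
proof -
  have [measurable_cong]: "sets \<mu> = sets M" using assms by (simp add: space_prob_algebra)
  show ?thesis unfolding law_Suc
    by (intro bind_assoc[symmetric, where N=M and R=M]) (auto intro!: measurable_prob_algebraD)
qed

text \<open>
  The induction on time for the oscillation needs the decomposition at the first step, whereas
  \<open>law\<close> is defined by the last one.
\<close>
lemma law_Suc':
  assumes "x \<in> space M"
  shows "law (Suc t) x = K x \<bind> law t"
proof (induction t)
  have Kx: "K x \<in> space (prob_algebra M)" using measurable_space[OF kernel assms] .
  case 0
  have "law (Suc 0) x = K x"
    unfolding law_Suc law_0 using assms by (intro bind_return[where N=M]) (auto intro!: measurable_prob_algebraD)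
  also have "\<dots> = K x \<bind> law 0"
    unfolding law_0[abs_def] using Kx by (intro bind_return''[symmetric]) (simp add: space_prob_algebra)
  finally show ?case .
next
  case (Suc t)
  then show ?case
    using bind_law_Suc[OF measurable_space[OF kernel assms], of t]
    by (metis law_Suc add_Suc_right)
qed

text \<open>
  The engine of the convergence: one step of the kernel contracts the oscillation of
  \<open>x \<mapsto> law t x A\<close> by the factor \<open>1 - c\<close>, because two first steps share mass \<open>c\<close>.
\<close>
lemma law_oscillation:
  assumes A: "A \<in> sets M" and "x \<in> space M" "y \<in> space M"
  shows "measure (law t x) A - measure (law t y) A \<le> (1 - c) ^ t"
  using assms(2,3)
proof (induction t arbitrary: x y)
  case 0
  show ?case using 0 A by (simp add: law_0 measure_return indicator_def)
next
  case (Suc t)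
  have K: "K z \<in> space (prob_algebra M)" if "z \<in> space M" for z
    using measurable_space[OF kernel that] .
  obtain \<eta> where \<eta>: "sets \<eta> = sets M" "\<eta> \<le> K x" "\<eta> \<le> K y" "c \<le> measure \<eta> (space M)"
    using overlap[OF Suc.prems] by blast
  have "(\<integral>z. measure (law t z) A \<partial>K x) - (\<integral>z. measure (law t z) A \<partial>K y) \<le> (1 - c) * (1 - c) ^ t"
    by (rule integral_diff_le_of_overlap[OF K K \<eta>]) (use Suc A in auto)
  then show ?case using Suc.prems A K by (simp add: law_Suc' measure_bind_law)
qed

lemma bind_law_close:
  assumes "A \<in> sets M" "\<mu> \<in> space (prob_algebra M)" "\<nu> \<in> space (prob_algebra M)"
  shows "\<bar>measure (\<mu> \<bind> law t) A - measure (\<nu> \<bind> law t) A\<bar> \<le> (1 - c) ^ t"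
  unfolding measure_bind_law[OF assms(2,1)] measure_bind_law[OF assms(3,1)]
  by (rule integral_diff_le_oscillation[OF assms(2,3)]) (use assms law_oscillation in auto)

lemma return_bind_law: "x \<in> space M \<Longrightarrow> return M x \<bind> law t = law t x"
  by (intro bind_return[where N=M]) (auto intro!: measurable_prob_algebraD)

lemma return_in: "x \<in> space M \<Longrightarrow> return M x \<in> space (prob_algebra M)"
  by (auto simp: space_prob_algebra prob_space_return)

lemma law_add:
  assumes "x \<in> space M"
  shows "law (n + t) x = law n x \<bind> law t"
proof (induction t)
  case 0
  show ?case unfolding law_0[abs_def] using law_in[OF assms, of n]
    by (simp add: bind_return'' space_prob_algebra)
next
  case (Suc t)
  then show ?case using bind_law_Suc[OF law_in[OF assms], of n t]
    by (metis law_Suc add_Suc_right)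
qed

text \<open>
  Running the chain for \<open>n\<close> extra steps amounts to starting it from \<open>law n x\<close> instead of \<open>x\<close>, so
  the laws form a Cauchy sequence, uniformly over measurable sets.
\<close>
lemma law_add_close:
  assumes "A \<in> sets M" "x \<in> space M"
  shows "\<bar>measure (law (n + t) x) A - measure (law t x) A\<bar> \<le> (1 - c) ^ t"
  using bind_law_close[OF assms(1) law_in[OF assms(2), of n] return_in[OF assms(2)], of t]
  by (simp add: law_add return_bind_law assms)

definition stationary :: "'a measure \<Rightarrow> bool" where
  "stationary \<pi> \<longleftrightarrow> \<pi> \<in> space (prob_algebra M) \<and> \<pi> \<bind> K = \<pi>"

lemma stationary_bind_law:
  assumes "stationary \<pi>"
  shows "\<pi> \<bind> law t = \<pi>"
proof (induction t)
  case 0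
  show ?case unfolding law_0[abs_def] using assms
    by (simp add: bind_return'' space_prob_algebra stationary_def)
next
  case (Suc t)
  then show ?case using bind_law_Suc[of \<pi> t] assms by (simp add: stationary_def)
qed

lemma stationary_close:
  assumes "stationary \<pi>" "x \<in> space M" "A \<in> sets M"
  shows "\<bar>measure \<pi> A - measure (law t x) A\<bar> \<le> (1 - c) ^ t"
  using bind_law_close[OF assms(3) _ return_in[OF assms(2)], of \<pi> t] assms
  by (simp add: stationary_bind_law return_bind_law stationary_def)

lemma rate_tendsto_0: "(\<lambda>t. (1 - c) ^ t) \<longlonglongrightarrow> 0"
  using c by (intro LIMSEQ_realpow_zero) auto

lemma stationary_unique:
  assumes "stationary \<pi>" "stationary \<pi>'"
  shows "\<pi> = \<pi>'"
proof (rule measure_eqI)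
  have pi: "\<pi> \<in> space (prob_algebra M)" "\<pi>' \<in> space (prob_algebra M)"
    using assms by (auto simp: stationary_def)
  interpret \<pi>: prob_space \<pi> using pi by (simp add: space_prob_algebra)
  interpret \<pi>': prob_space \<pi>' using pi by (simp add: space_prob_algebra)
  show "sets \<pi> = sets \<pi>'" using pi by (simp add: space_prob_algebra)
  fix A assume "A \<in> sets \<pi>"
  then have A: "A \<in> sets M" using pi by (simp add: space_prob_algebra)
  have "\<bar>measure \<pi> A - measure \<pi>' A\<bar> \<le> (1 - c) ^ t" for t
    using bind_law_close[OF A pi, of t] assms by (simp add: stationary_bind_law)
  then have "\<bar>measure \<pi> A - measure \<pi>' A\<bar> \<le> 0"
    by (intro LIMSEQ_le_const[OF rate_tendsto_0]) auto
  then show "emeasure \<pi> A = emeasure \<pi>' A"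
    by (simp add: \<pi>.emeasure_eq_measure \<pi>'.emeasure_eq_measure)
qed

text \<open>
  The stationary law is the setwise limit of \<open>law t x\<close>. Because the convergence is uniform in the
  set, continuity at the empty set, and with it countable additivity, passes to the limit. Uniformity
  also allows passing to the limit in \<open>law (Suc t) x = law t x \<bind> K\<close>, although \<open>K\<close> is only
  measurable, by \<open>integral_diff_le_of_setwise\<close>.
\<close>
lemma ex_stationary: "\<exists>\<pi>. stationary \<pi>"
proof -
  obtain x where x: "x \<in> space M" using not_empty by auto
  define p where "p A = lim (\<lambda>t. measure (law t x) A)" for A
  have ps: "prob_space (law t x)" "sets (law t x) = sets M" "space (law t x) = space M" for t
    using law_in[OF x, of t] by (auto simp: space_prob_algebra dest: sets_eq_imp_space_eq)
  have lim: "(\<lambda>t. measure (law t x) A) \<longlonglongrightarrow> p A" if A: "A \<in> sets M" for A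
  proof -
    have "Cauchy (\<lambda>t. measure (law t x) A)"
    proof (rule metric_CauchyI)
      fix e :: real assume "0 < e"
      then obtain t where t: "(1 - c) ^ t < e / 2"
        using order_tendstoD(2)[OF rate_tendsto_0, of "e/2"] by (auto simp: eventually_sequentially)
      have "dist (measure (law m x) A) (measure (law t x) A) < e / 2" if "m \<ge> t" for m
        using law_add_close[OF A x, of "m - t" t] t that by (simp add: dist_real_def)
      then show "\<exists>N. \<forall>m\<ge>N. \<forall>n\<ge>N. dist (measure (law m x) A) (measure (law n x) A) < e"
        by (meson dist_triangle_half_l)
    qed
    then show ?thesis
      unfolding p_def by (simp add: Cauchy_convergent convergent_LIMSEQ_iff[symmetric])
  qed
  have close: "\<bar>p A - measure (law t x) A\<bar> \<le> (1 - c) ^ t" if A: "A \<in> sets M" for A t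
  proof (rule LIMSEQ_le_const2)
    show "(\<lambda>n. \<bar>measure (law (n + t) x) A - measure (law t x) A\<bar>) \<longlonglongrightarrow> \<bar>p A - measure (law t x) A\<bar>"
      by (intro tendsto_intros LIMSEQ_ignore_initial_segment lim A)
  qed (use law_add_close[OF A x] in auto)
  have p0: "0 \<le> p A" if "A \<in> sets M" for A
    using lim[OF that] by (rule LIMSEQ_le_const) auto
  have p1: "p (space M) = 1"
  proof -
    have "measure (law t x) (space M) = 1" for t
      using prob_space.prob_space[OF ps(1)] ps(3) by simp
    then show ?thesis unfolding p_def by simp
  qed
  have p_add: "p (A \<union> B) = p A + p B" if "A \<in> sets M" "B \<in> sets M" "A \<inter> B = {}" for A B
  proof (rule LIMSEQ_unique[OF lim])
    have "measure (law t x) (A \<union> B) = measure (law t x) A + measure (law t x) B" for t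
      using that finite_measure.finite_measure_Union[of "law t x" A B] ps(1)[of t] ps(2)[of t]
      by (simp add: prob_space_def)
    then show "(\<lambda>t. measure (law t x) (A \<union> B)) \<longlonglongrightarrow> p A + p B"
      using tendsto_add[OF lim lim] that by simp
  qed (use that in auto)
  have p_empty: "p {} = 0" using p_add[of "{}" "{}"] by simp
  have cont: "(\<lambda>i. p (A i)) \<longlonglongrightarrow> 0"
    if A: "range A \<subseteq> sets M" "decseq A" "(\<Inter>i. A i) = {}" for A
  proof (rule tendstoI)
    fix e :: real assume "0 < e"
    then obtain t where t: "(1 - c) ^ t < e / 2"
      using order_tendstoD(2)[OF rate_tendsto_0, of "e/2"] by (auto simp: eventually_sequentially)
    interpret prob_space "law t x" by (rule ps)
    have "(\<lambda>i. measure (law t x) (A i)) \<longlonglongrightarrow> measure (law t x) (\<Inter>i. A i)"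
      using A ps(2)[of t] by (intro finite_Lim_measure_decseq) auto
    then have "eventually (\<lambda>i. measure (law t x) (A i) < e / 2) sequentially"
      using order_tendstoD(2)[of _ 0 sequentially "e/2"] A(3) \<open>0 < e\<close> by simp
    then show "eventually (\<lambda>i. dist (p (A i)) 0 < e) sequentially"
    proof eventually_elim
      case (elim i)
      have "A i \<in> sets M" using A by auto
      then show ?case using close[of "A i" t] p0[of "A i"] elim t by (simp add: dist_real_def)
    qed
  qed
  define \<pi> where "\<pi> = measure_of (space M) (sets M) (\<lambda>A. ennreal (p A))"
  have [simp]: "sets \<pi> = sets M" "space \<pi> = space M"
    unfolding \<pi>_def by (simp_all add: sets.sets_measure_of_eq sets.space_measure_of_eq)
  have em: "emeasure \<pi> A = ennreal (p A)" if "A \<in> sets M" for A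
    unfolding \<pi>_def
  proof (rule emeasure_measure_of_sigma[OF sets.sigma_algebra_axioms])
    show pos: "positive (sets M) (\<lambda>A. ennreal (p A))" by (simp add: positive_def p_empty)
    show "countably_additive (sets M) (\<lambda>A. ennreal (p A))"
    proof (rule sets.empty_continuous_imp_countably_additive[OF pos])
      show "additive (sets M) (\<lambda>A. ennreal (p A))"
        unfolding additive_def using p_add p0 by (auto simp: ennreal_plus)
      show "(\<lambda>i. ennreal (p (A i))) \<longlonglongrightarrow> 0"
        if "range A \<subseteq> sets M" "decseq A" "(\<Inter>i. A i) = {}" for A
        using tendsto_ennrealI[OF cont[OF that]] by simp
    qed auto
  qed (rule that)
  have meas: "measure \<pi> A = p A" if "A \<in> sets M" for A
    using em[OF that] p0[OF that] by (simp add: measure_def)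
  have pi: "\<pi> \<in> space (prob_algebra M)"
    by (auto simp: space_prob_algebra em p1 intro!: prob_spaceI)
  interpret prob_space \<pi> using pi by (simp add: space_prob_algebra)
  have "\<pi> \<bind> K = \<pi>"
  proof (rule measure_eqI)
    have [measurable_cong]: "sets \<pi> = sets M" by simp
    interpret PK: prob_space "\<pi> \<bind> K" by (rule prob_space_bind'[OF pi kernel])
    show *: "sets (\<pi> \<bind> K) = sets \<pi>" using sets_bind'[OF pi kernel] by simp
    fix A assume "A \<in> sets (\<pi> \<bind> K)"
    then have A: "A \<in> sets M" using * by simp
    have g: "(\<lambda>y. measure (K y) A) \<in> borel_measurable M" using A by measurable
    have g01: "0 \<le> measure (K y) A \<and> measure (K y) A \<le> 1" if "y \<in> space M" for y
      using measurable_space[OF kernel that] by (auto simp: space_prob_algebra prob_space.prob_le_1)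
    have bd: "\<bar>measure (\<pi> \<bind> K) A - measure (law (Suc t) x) A\<bar> \<le> (1 - c) ^ t" for t
    proof -
      have 1: "measure (\<mu> \<bind> K) A = (\<integral>y. measure (K y) A \<partial>\<mu>)"
        if "\<mu> \<in> space (prob_algebra M)" for \<mu>
      proof -
        have "subprob_space \<mu>"
          using that by (simp add: space_prob_algebra prob_space_imp_subprob_space)
        have [measurable_cong]: "sets \<mu> = sets M" using that by (simp add: space_prob_algebra)
        then show ?thesis using A \<open>subprob_space \<mu>\<close>
          by (intro subprob_space.measure_bind[where N=M]) (auto intro!: measurable_prob_algebraD)
      qed
      show ?thesis
        unfolding law_Suc 1[OF pi] 1[OF law_in[OF x]] abs_le_iff
        using integral_diff_le_of_setwise[OF pi law_in[OF x, of t] _ g g01, of "(1 - c) ^ t"]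
          integral_diff_le_of_setwise[OF law_in[OF x, of t] pi _ g g01, of "(1 - c) ^ t"]
          close[of _ t] by (auto simp: meas abs_le_iff)
    qed
    have "(\<lambda>t. measure (\<pi> \<bind> K) A - measure (law (Suc t) x) A) \<longlonglongrightarrow> 0"
      by (rule Lim_null_comparison[OF _ rate_tendsto_0]) (use bd in auto)
    moreover have "(\<lambda>t. measure (\<pi> \<bind> K) A - measure (law (Suc t) x) A)
        \<longlonglongrightarrow> measure (\<pi> \<bind> K) A - measure \<pi> A"
      unfolding meas[OF A] by (intro tendsto_intros LIMSEQ_Suc lim A)
    ultimately have "measure (\<pi> \<bind> K) A - measure \<pi> A = 0" by (rule LIMSEQ_unique[symmetric])
    then show "emeasure (\<pi> \<bind> K) A = emeasure \<pi> A"
      by (simp add: emeasure_eq_measure PK.emeasure_eq_measure)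
  qed
  then show ?thesis using pi by (auto simp: stationary_def)
qed

end

section \<open>Measurability of the distance\<close>

text \<open>
  The class of metric spaces does not include separability, which is where compactness enters.
\<close>
lemma ex_countable_dense_of_compact:
  assumes "compact (UNIV :: 'a::metric_space set)"
  shows "\<exists>D :: 'a set. countable D \<and> D \<noteq> {} \<and> (\<forall>x. \<forall>e>0. \<exists>d\<in>D. dist x d < e)"
proof -
  have "\<exists>F. finite F \<and> (UNIV :: 'a set) \<subseteq> (\<Union>x\<in>F. ball x (1 / Suc n))" for n :: nat
    using seq_compact_imp_totally_bounded[OF compact_imp_seq_compact[OF assms]] by force
  then obtain F where F: "\<And>n. finite (F n)" "\<And>n::nat. (UNIV :: 'a set) \<subseteq> (\<Union>x\<in>F n. ball x (1 / Suc n))"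
    by metis
  have dense: "\<exists>d\<in>(\<Union>n. F n). dist x d < e" if e: "e > 0" for x e
  proof -
    obtain n where n: "1 / Suc n < e" by (rule nat_approx_posE[OF e])
    obtain d where "d \<in> F n" "dist d x < 1 / Suc n" using F(2)[of n] by (auto simp: subset_eq)
    then show ?thesis using n by (intro bexI[of _ d]) (auto simp: dist_commute)
  qed
  have "(\<Union>n. F n) \<noteq> {}"
    using dense[OF zero_less_one, of undefined] by (rule contrapos_pn) simp
  moreover have "countable (\<Union>n. F n)" using F(1) by (auto intro: countable_finite)
  ultimately show ?thesis using dense by (intro exI[of _ "\<Union>n. F n"]) simp
qed

text \<open>
  Continuity of the distance does not give joint measurability, since the Borel sets of a product
  space need not be generated by rectangles. Separability helps: the distance is an infimum, over a
  countable dense set, of sums of functions of one variable.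
\<close>
lemma borel_measurable_dist_of_compact:
  assumes "compact (UNIV :: 'a::metric_space set)"
    and [measurable]: "f \<in> M \<rightarrow>\<^sub>M (borel :: 'a measure)" "g \<in> M \<rightarrow>\<^sub>M borel"
  shows "(\<lambda>x. dist (f x) (g x)) \<in> borel_measurable M"
proof -
  obtain D :: "'a set" where D: "countable D" "D \<noteq> {}" "\<And>x e. e > 0 \<Longrightarrow> \<exists>d\<in>D. dist x d < e"
    using ex_countable_dense_of_compact[OF assms(1)] by blast
  have [measurable]: "(\<lambda>x. dist x d) \<in> borel_measurable borel" for d :: 'a
    by (intro borel_measurable_continuous_onI continuous_intros)
  have eq: "dist u v = (INF d\<in>D. dist u d + dist v d)" for u v :: 'a
  proof (rule antisym)
    show "dist u v \<le> (INF d\<in>D. dist u d + dist v d)"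
      using D(2) by (intro cINF_greatest) (auto simp: dist_triangle2)
    show "(INF d\<in>D. dist u d + dist v d) \<le> dist u v"
    proof (rule field_le_epsilon)
      fix e :: real assume "0 < e"
      then obtain d where d: "d \<in> D" "dist u d < e / 2" using D(3)[of "e/2" u] by auto
      have "(INF d\<in>D. dist u d + dist v d) \<le> dist u d + dist v d"
        using d(1) by (intro cINF_lower) (auto intro!: bdd_belowI[of _ 0])
      also have "\<dots> \<le> dist u v + e" using d(2) dist_triangle[of v d u] by (simp add: dist_commute)
      finally show "(INF d\<in>D. dist u d + dist v d) \<le> dist u v + e" .
    qed
  qed
  have "(\<lambda>x. INF d\<in>D. dist (f x) d + dist (g x) d) \<in> borel_measurable M"
    using D(1) by (intro borel_measurable_cINF_real) auto
  then show ?thesis unfolding eq[symmetric] .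
qed

section \<open>Ranks and selection by rank\<close>

text \<open>
  The index as a second criterion makes this a linear order, so that ranks are distinct even when
  distances coincide.
\<close>
definition precedes :: "'a::metric_space \<Rightarrow> (nat \<Rightarrow> 'a) \<Rightarrow> nat \<Rightarrow> nat \<Rightarrow> bool" where
  "precedes s Z m i \<longleftrightarrow> dist s (Z m) < dist s (Z i) \<or> dist s (Z m) = dist s (Z i) \<and> m \<le> i"

definition rank_within :: "'a::metric_space \<Rightarrow> (nat \<Rightarrow> 'a) \<Rightarrow> nat set \<Rightarrow> nat \<Rightarrow> nat" where
  "rank_within s Z B i = card {m \<in> B. precedes s Z m i}"

lemma bij_betw_rank_within:
  assumes "finite B"
  shows "bij_betw (rank_within s Z B) B {1..card B}"
proof -
  have lt: "rank_within s Z B m < rank_within s Z B i"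
    if "m \<in> B" "i \<in> B" "precedes s Z m i" "m \<noteq> i" for m i
    unfolding rank_within_def
  proof (rule psubset_card_mono)
    show "{l \<in> B. precedes s Z l m} \<subset> {l \<in> B. precedes s Z l i}"
      using that unfolding precedes_def psubset_eq by auto
  qed (use assms in auto)
  have inj: "inj_on (rank_within s Z B) B"
  proof (rule inj_onI, rule ccontr)
    fix m i assume mi: "m \<in> B" "i \<in> B" "rank_within s Z B m = rank_within s Z B i" "m \<noteq> i"
    have "precedes s Z m i \<or> precedes s Z i m" unfolding precedes_def by auto
    then show False using lt[of m i] lt[of i m] mi by auto
  qed
  have "rank_within s Z B ` B \<subseteq> {1..card B}"
  proof
    fix r assume "r \<in> rank_within s Z B ` B"
    then obtain i where i: "i \<in> B" "r = card {m \<in> B. precedes s Z m i}"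
      by (auto simp: rank_within_def)
    have "i \<in> {m \<in> B. precedes s Z m i}" using i by (simp add: precedes_def)
    then have "r > 0" using i assms by (auto simp: card_gt_0_iff)
    moreover have "r \<le> card B" using i assms by (auto intro: card_mono)
    ultimately show "r \<in> {1..card B}" by simp
  qed
  then have "rank_within s Z B ` B = {1..card B}"
    using card_image[OF inj] by (intro card_subset_eq) auto
  then show ?thesis using inj by (simp add: bij_betw_def)
qed

text \<open>
  Relabelling the samples along \<open>e\<close> turns the priorities \<open>\<sigma>\<close> into the natural order of the labels.
  This serves two purposes: \<open>e = \<sigma>\<close> removes the random tie breaking, and an increasing
  enumeration \<open>e\<close> embeds \<open>k\<close> samples into a larger pool.
\<close>
lemma dist_rank_eq_rank_within:
  assumes "inj_on e {..<k}" "\<And>l. l < k \<Longrightarrow> \<sigma> l \<le> \<sigma> i \<longleftrightarrow> e l \<le> e i"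
    and "\<And>l. l < k \<Longrightarrow> Y l = Z (e l)" "i < k"
  shows "dist_rank k s Y \<sigma> i = rank_within s Z (e ` {..<k}) (e i)"
proof -
  have "{m \<in> e ` {..<k}. precedes s Z m (e i)} =
    e ` {l. l < k \<and> (dist s (Y l) < dist s (Y i) \<or> dist s (Y l) = dist s (Y i) \<and> \<sigma> l \<le> \<sigma> i)}"
    using assms(2-) unfolding precedes_def by auto
  moreover have "inj_on e {l. l < k \<and> (dist s (Y l) < dist s (Y i) \<or> dist s (Y l) = dist s (Y i) \<and> \<sigma> l \<le> \<sigma> i)}"
    using assms(1) by (rule inj_on_subset) auto
  ultimately show ?thesis
    unfolding dist_rank_def rank_within_def by (simp add: card_image)
qed

lemma jth_nearest_eq:
  assumes e: "inj_on e {..<k}" "\<And>l i. l < k \<Longrightarrow> i < k \<Longrightarrow> \<sigma> l \<le> \<sigma> i \<longleftrightarrow> e l \<le> e i"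
    and Y: "\<And>l. l < k \<Longrightarrow> Y l = Z (e l)"
    and i: "i \<in> e ` {..<k}" "rank_within s Z (e ` {..<k}) i = j"
  shows "jth_nearest j k s Y \<sigma> = Z i"
proof -
  obtain i0 where i0: "i0 < k" "i = e i0" using i by auto
  have "(THE i. i < k \<and> dist_rank k s Y \<sigma> i = j) = i0"
  proof (rule the_equality)
    show "i0 < k \<and> dist_rank k s Y \<sigma> i0 = j"
      using dist_rank_eq_rank_within[of e k \<sigma> i0 Y Z s] e Y i0 i by auto
    fix l assume l: "l < k \<and> dist_rank k s Y \<sigma> l = j"
    then have "rank_within s Z (e ` {..<k}) (e l) = rank_within s Z (e ` {..<k}) (e i0)"
      using dist_rank_eq_rank_within[of e k \<sigma> l Y Z s] e Y i0 i by auto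
    then have "e l = e i0"
      using bij_betw_rank_within[of "e ` {..<k}" s Z] l i0
      by (auto simp: bij_betw_def dest!: inj_onD)
    then show "l = i0" using e(1) l i0 by (auto dest: inj_onD)
  qed
  then show ?thesis unfolding jth_nearest_def using Y i0 by simp
qed

lemma jth_nearest_tie_break_by_index:
  assumes "\<sigma> permutes {..<k}" "1 \<le> j" "j \<le> k"
  shows "jth_nearest j k s Y \<sigma> = jth_nearest j k s (\<lambda>n\<in>{..<k}. Y (inv \<sigma> n)) id"
proof -
  define Z where "Z = (\<lambda>n\<in>{..<k}. Y (inv \<sigma> n))"
  have im: "\<sigma> ` {..<k} = {..<k}" "inj_on \<sigma> {..<k}"
    using assms(1) by (auto simp: permutes_image permutes_inj_on)
  have "rank_within s Z {..<k} ` {..<k} = {1..k}"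
    using bij_betw_imp_surj_on[OF bij_betw_rank_within[of "{..<k}" s Z]] by simp
  moreover have "j \<in> {1..k}" using assms by simp
  ultimately obtain i where i: "i \<in> {..<k}" "rank_within s Z {..<k} i = j"
    by (metis imageE)
  have "jth_nearest j k s Y \<sigma> = Z i"
  proof (rule jth_nearest_eq[OF im(2)])
    show "Y l = Z (\<sigma> l)" if "l < k" for l
      unfolding Z_def using that permutes_in_image[OF assms(1), of l] permutes_inverses[OF assms(1)] by simp
  qed (use im i in auto)
  moreover have "jth_nearest j k s Z id = Z i"
    by (rule jth_nearest_eq[of id]) (use i in auto)
  ultimately show ?thesis unfolding Z_def by simp
qed

text \<open>
  An index with at least \<open>j - 1\<close> predecessors and at least \<open>k - j\<close> successors becomes the \<open>j\<close>'th one
  of a \<open>k\<close>-subset consisting of itself, \<open>j - 1\<close> predecessors and \<open>k - j\<close> successors.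
\<close>
lemma ex_subset_with_rank:
  assumes "finite I" "i \<in> I" "1 \<le> j" "j \<le> k"
    and lo: "j \<le> rank_within s Z I i"
    and hi: "rank_within s Z I i + (k - j) \<le> card I"
  shows "\<exists>B\<subseteq>I. card B = k \<and> i \<in> B \<and> rank_within s Z B i = j"
proof -
  define L where "L = {m \<in> I. precedes s Z m i} - {i}"
  define U where "U = {m \<in> I. \<not> precedes s Z m i}"
  have ii: "precedes s Z i i" by (simp add: precedes_def)
  have "card L = rank_within s Z I i - 1"
    unfolding L_def rank_within_def using assms ii by (subst card_Diff_singleton) auto
  moreover have "rank_within s Z I i + card U = card I"
  proof -
    have "card I = card ({m \<in> I. precedes s Z m i} \<union> U)"
      unfolding U_def by (rule arg_cong[of _ _ card]) auto
    also have "\<dots> = rank_within s Z I i + card U"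
      unfolding rank_within_def U_def using assms by (intro card_Un_disjoint) auto
    finally show ?thesis by simp
  qed
  ultimately have "j - 1 \<le> card L" "k - j \<le> card U" using lo hi by auto
  then obtain L' U' where L': "L' \<subseteq> L" "card L' = j - 1" "finite L'"
    and U': "U' \<subseteq> U" "card U' = k - j" "finite U'"
    by (metis obtain_subset_with_card_n)
  have d: "i \<notin> L'" "i \<notin> U'" "L' \<inter> U' = {}" using L' U' ii unfolding L_def U_def by auto
  have "{m \<in> insert i (L' \<union> U'). precedes s Z m i} = insert i L'"
    using L' U' ii unfolding L_def U_def by auto
  then have "rank_within s Z (insert i (L' \<union> U')) i = j"
    unfolding rank_within_def using L' d assms by simp
  moreover have "card (insert i (L' \<union> U')) = k"
    using L' U' d assms by (simp add: card_Un_disjoint)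
  moreover have "insert i (L' \<union> U') \<subseteq> I" using L' U' assms unfolding L_def U_def by auto
  ultimately show ?thesis by (intro exI[of _ "insert i (L' \<union> U')"]) auto
qed

lemma card_extreme_rank:
  assumes "finite I" "card I = 2 * k - 1" "1 \<le> j" "j \<le> k"
  shows "card {i \<in> I. rank_within s Z I i \<notin> {j..j + k - 1}} = k - 1"
proof -
  have b: "bij_betw (rank_within s Z I) I {1..2 * k - 1}"
    using bij_betw_rank_within[OF assms(1), of s Z] assms(2) by simp
  have "rank_within s Z I ` {i \<in> I. rank_within s Z I i \<notin> {j..j + k - 1}} = rank_within s Z I ` I - {j..j + k - 1}"
    by auto
  then have "rank_within s Z I ` {i \<in> I. rank_within s Z I i \<notin> {j..j + k - 1}} = {1..2 * k - 1} - {j..j + k - 1}"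
    unfolding bij_betw_imp_surj_on[OF b] .
  moreover have inj: "inj_on (rank_within s Z I) {i \<in> I. rank_within s Z I i \<notin> {j..j + k - 1}}"
    using b unfolding bij_betw_def by (auto intro: inj_on_subset)
  moreover have "card ({1..2 * k - 1} - {j..j + k - 1}) = k - 1"
    using assms by (subst card_Diff_subset) auto
  ultimately show ?thesis using card_image[OF inj] by argo
qed

text \<open>
  Among \<open>2 * k - 1\<close> indices, each of the two orders excludes only \<open>k - 1\<close> of them as too early or
  too late to be the \<open>j\<close>'th one of a \<open>k\<close>-subset, so at least one index survives both exclusions.
\<close>
lemma ex_common_middle_rank:
  assumes "finite I" "card I = 2 * k - 1" "1 \<le> j" "j \<le> k"
  shows "\<exists>i\<in>I. rank_within s Z I i \<in> {j..j + k - 1} \<and> rank_within s' Z I i \<in> {j..j + k - 1}"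
proof (rule ccontr)
  let ?E = "\<lambda>s. {i \<in> I. rank_within s Z I i \<notin> {j..j + k - 1}}"
  assume "\<not> ?thesis"
  then have "I \<subseteq> ?E s \<union> ?E s'" by blast
  then have "card I \<le> card (?E s \<union> ?E s')" using assms by (intro card_mono) auto
  also have "\<dots> \<le> (k - 1) + (k - 1)"
    using card_Un_le[of "?E s" "?E s'"] unfolding card_extreme_rank[OF assms] .
  finally show False using assms by simp
qed

section \<open>The law of the nearest-sample transition\<close>

text \<open>
  Used to discard the random permutation: given its value, the law of the selected point is always
  the same.
\<close>
lemma distr_pair_measure_eq_of_sections:
  assumes M: "prob_space M" "prob_space U"
    and f: "f \<in> M \<Otimes>\<^sub>M U \<rightarrow>\<^sub>M N"
    and eq: "\<And>u. u \<in> space U \<Longrightarrow> distr M N (\<lambda>x. f (x, u)) = \<nu>"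
  shows "distr (M \<Otimes>\<^sub>M U) N f = \<nu>"
proof -
  interpret M: prob_space M by fact
  interpret U: prob_space U by fact
  interpret pair_sigma_finite M U ..
  obtain u0 where u0: "u0 \<in> space U" using U.not_empty by auto
  show ?thesis
  proof (rule measure_eqI)
    show "sets (distr (M \<Otimes>\<^sub>M U) N f) = sets \<nu>" using eq[OF u0] by auto
    fix A assume "A \<in> sets (distr (M \<Otimes>\<^sub>M U) N f)"
    then have A: "A \<in> sets N" by simp
    let ?P = "f -` A \<inter> space (M \<Otimes>\<^sub>M U)"
    have "emeasure (distr (M \<Otimes>\<^sub>M U) N f) A = (\<integral>\<^sup>+u. emeasure M ((\<lambda>x. (x, u)) -` ?P) \<partial>U)"
      unfolding emeasure_distr[OF f A]
      by (rule emeasure_pair_measure_alt2[OF measurable_sets[OF f A]])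
    also have "\<dots> = (\<integral>\<^sup>+u. emeasure \<nu> A \<partial>U)"
    proof (rule nn_integral_cong)
      fix u assume u: "u \<in> space U"
      have "(\<lambda>x. f (x, u)) \<in> M \<rightarrow>\<^sub>M N" using f u by measurable
      then have "emeasure (distr M N (\<lambda>x. f (x, u))) A = emeasure M ((\<lambda>x. f (x, u)) -` A \<inter> space M)"
        using A by (rule emeasure_distr)
      also have "(\<lambda>x. f (x, u)) -` A \<inter> space M = (\<lambda>x. (x, u)) -` ?P"
        using u by (auto simp: space_pair_measure)
      finally show "emeasure M ((\<lambda>x. (x, u)) -` ?P) = emeasure \<nu> A" using eq[OF u] by simp
    qed
    also have "\<dots> = emeasure \<nu> A" by (simp add: U.emeasure_space_1)
    finally show "emeasure (distr (M \<Otimes>\<^sub>M U) N f) A = emeasure \<nu> A" .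
  qed
qed

locale nearest_chain =
  fixes \<theta> :: "'a::metric_space measure" and j k :: nat
  assumes compact_UNIV: "compact (UNIV :: 'a set)"
    and prob_space_\<theta>: "prob_space \<theta>" and sets_\<theta>[measurable_cong]: "sets \<theta> = sets borel"
    and j_ge: "1 \<le> j" and j_le: "j \<le> k"
begin

lemma space_\<theta>: "space \<theta> = UNIV"
  using sets_eq_imp_space_eq[OF sets_\<theta>] by simp

abbreviation samples :: "nat \<Rightarrow> (nat \<Rightarrow> 'a) measure" where
  "samples n \<equiv> (\<Pi>\<^sub>M i\<in>{..<n}. \<theta>)"

lemma prob_space_samples: "prob_space (samples n)"
  by (rule prob_space_PiM) (rule prob_space_\<theta>)

lemma measurable_sample:
  assumes "g \<in> M \<rightarrow>\<^sub>M samples n" "i < n"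
  shows "(\<lambda>p. g p i) \<in> M \<rightarrow>\<^sub>M borel"
  using measurable_compose[OF assms(1) measurable_component_singleton[of i "{..<n}" "\<lambda>_. \<theta>"]] assms(2)
  by (simp add: sets_\<theta> cong: measurable_cong_sets)

lemma measurable_selected_sample:
  assumes "g \<in> M \<rightarrow>\<^sub>M samples n" "idx \<in> M \<rightarrow>\<^sub>M count_space {..<n}"
  shows "(\<lambda>p. g p (idx p)) \<in> M \<rightarrow>\<^sub>M borel"
  by (rule measurable_compose_countable'[where f="\<lambda>i p. g p i", OF _ assms(2)])
    (use measurable_sample[OF assms(1)] in auto)

lemma measurable_rank_within:
  assumes f[measurable]: "f \<in> M \<rightarrow>\<^sub>M (borel :: 'a measure)" and g[measurable]: "g \<in> M \<rightarrow>\<^sub>M samples n"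
    and B: "B \<subseteq> {..<n}" and i: "i < n"
  shows "(\<lambda>p. rank_within (f p) (g p) B i) \<in> M \<rightarrow>\<^sub>M count_space UNIV"
proof -
  have fin: "finite B" using B by (rule finite_subset) auto
  have "{p \<in> space M. precedes (f p) (g p) m i} \<in> sets M" if "m \<in> B" for m
  proof -
    have "m < n" using that B by auto
    then have [measurable]: "(\<lambda>p. dist (f p) (g p m)) \<in> borel_measurable M"
        "(\<lambda>p. dist (f p) (g p i)) \<in> borel_measurable M"
      using borel_measurable_dist_of_compact[OF compact_UNIV f measurable_sample[OF g]] i by auto
    show ?thesis unfolding precedes_def by measurable
  qed
  then have [measurable]: "Measurable.pred M (\<lambda>p. precedes (f p) (g p) m i)" if "m \<in> B" for m
    using that by (simp add: pred_def)
  have "(\<lambda>p. \<Sum>m\<in>B. if precedes (f p) (g p) m i then 1 else 0 :: nat) \<in> M \<rightarrow>\<^sub>M count_space UNIV"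
    by measurable
  then show ?thesis unfolding rank_within_def using fin by (simp add: sum.If_cases Int_def)
qed

lemma ex1_rank: "\<exists>!i. i < k \<and> rank_within s Y {..<k} i = j"
proof -
  have b: "bij_betw (rank_within s Y {..<k}) {..<k} {1..k}"
    using bij_betw_rank_within[of "{..<k}" s Y] by simp
  have "j \<in> rank_within s Y {..<k} ` {..<k}"
    unfolding bij_betw_imp_surj_on[OF b] using j_ge j_le by simp
  then show ?thesis using bij_betw_imp_inj_on[OF b] by (auto dest: inj_onD)
qed

lemma jth_nearest_id_eq:
  assumes "i < k" "rank_within s Y {..<k} i = j"
  shows "jth_nearest j k s Y id = Y i"
  by (rule jth_nearest_eq[of id]) (use assms in auto)

lemma measurable_jth_nearest:
  assumes f[measurable]: "f \<in> M \<rightarrow>\<^sub>M (borel :: 'a measure)" and g[measurable]: "g \<in> M \<rightarrow>\<^sub>M samples k"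
  shows "(\<lambda>p. jth_nearest j k (f p) (g p) id) \<in> M \<rightarrow>\<^sub>M borel"
proof -
  define idx where "idx p = (THE i. i < k \<and> rank_within (f p) (g p) {..<k} i = j)" for p
  have idx: "idx p < k \<and> rank_within (f p) (g p) {..<k} (idx p) = j" for p
    unfolding idx_def by (rule theI'[OF ex1_rank])
  have idx_eq: "idx p = i \<longleftrightarrow> rank_within (f p) (g p) {..<k} i = j" if "i < k" for p i
    using idx[of p] ex1_rank[of "f p" "g p"] that by auto
  have "idx \<in> M \<rightarrow>\<^sub>M count_space {..<k}"
  proof (subst measurable_count_space_eq2, simp, intro conjI ballI)
    fix i assume i: "i \<in> {..<k}"
    then have [measurable]: "(\<lambda>p. rank_within (f p) (g p) {..<k} i) \<in> M \<rightarrow>\<^sub>M count_space UNIV"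
      by (intro measurable_rank_within[OF f g]) auto
    have "idx -` {i} \<inter> space M = {p \<in> space M. rank_within (f p) (g p) {..<k} i = j}"
      using idx_eq i by auto
    also have "\<dots> \<in> sets M" by measurable
    finally show "idx -` {i} \<inter> space M \<in> sets M" .
  qed (use idx in auto)
  then have "(\<lambda>p. g p (idx p)) \<in> M \<rightarrow>\<^sub>M borel"
    by (rule measurable_selected_sample[OF g])
  moreover have "jth_nearest j k (f p) (g p) id = g p (idx p)" for p
    using idx by (intro jth_nearest_id_eq) auto
  ultimately show ?thesis by simp
qed

text \<open>
  The samples are exchangeable, so breaking ties by a random permutation has the same effect as
  breaking them by index: permuting the samples turns one rule into the other and preserves their law.
\<close>
lemma nearest_kernel_eq:
  "nearest_kernel \<theta> j k s = distr (samples k) borel (\<lambda>Y. jth_nearest j k s Y id)"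
proof -
  let ?P = "{\<sigma>. \<sigma> permutes {..<k}}"
  have fin: "finite ?P" by (simp add: finite_permutations)
  have ne: "?P \<noteq> {}" using permutes_id by blast
  define \<rho> where "\<rho> \<sigma> = (\<lambda>Y. \<lambda>n\<in>{..<k}. Y (inv \<sigma> n) :: 'a)" for \<sigma> :: "nat \<Rightarrow> nat"
  have inv: "inj_on (inv \<sigma>) {..<k}" "inv \<sigma> \<in> {..<k} \<rightarrow> {..<k}" if "\<sigma> \<in> ?P" for \<sigma>
    using permutes_inv[of \<sigma> "{..<k}"] permutes_in_image[of "inv \<sigma>" "{..<k}"] that
    by (auto simp: permutes_inj_on)
  have \<rho>: "\<rho> \<sigma> \<in> samples k \<rightarrow>\<^sub>M samples k" "distr (samples k) (samples k) (\<rho> \<sigma>) = samples k"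
    if "\<sigma> \<in> ?P" for \<sigma>
  proof -
    show "\<rho> \<sigma> \<in> samples k \<rightarrow>\<^sub>M samples k"
      unfolding \<rho>_def using inv[OF that]
      by (intro measurable_restrict measurable_component_singleton) auto
    show "distr (samples k) (samples k) (\<rho> \<sigma>) = samples k"
      unfolding \<rho>_def using distr_PiM_reindex[OF _ inv[OF that], of "\<lambda>_. \<theta>"] prob_space_\<theta> by simp
  qed
  have tie: "jth_nearest j k s Y \<sigma> = jth_nearest j k s (\<rho> \<sigma> Y) id" if "\<sigma> \<in> ?P" for Y \<sigma>
    unfolding \<rho>_def using jth_nearest_tie_break_by_index[of \<sigma> k j s Y] that j_ge j_le by simp
  have idm: "(\<lambda>Y. jth_nearest j k s Y id) \<in> samples k \<rightarrow>\<^sub>M borel"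
    by (intro measurable_jth_nearest) auto
  have sect: "(\<lambda>Y. jth_nearest j k s Y \<sigma>) \<in> samples k \<rightarrow>\<^sub>M borel"
    "distr (samples k) borel (\<lambda>Y. jth_nearest j k s Y \<sigma>) = distr (samples k) borel (\<lambda>Y. jth_nearest j k s Y id)"
    if "\<sigma> \<in> ?P" for \<sigma>
  proof -
    show "(\<lambda>Y. jth_nearest j k s Y \<sigma>) \<in> samples k \<rightarrow>\<^sub>M borel"
      unfolding tie[OF that] by (rule measurable_compose[OF \<rho>(1)[OF that] idm])
    have "distr (distr (samples k) (samples k) (\<rho> \<sigma>)) borel (\<lambda>Y. jth_nearest j k s Y id)
        = distr (samples k) borel (\<lambda>Y. jth_nearest j k s Y \<sigma>)"
      unfolding tie[OF that] using distr_distr[OF idm \<rho>(1)[OF that]] by (simp add: comp_def)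
    then show "distr (samples k) borel (\<lambda>Y. jth_nearest j k s Y \<sigma>)
        = distr (samples k) borel (\<lambda>Y. jth_nearest j k s Y id)"
      unfolding \<rho>(2)[OF that] by simp
  qed
  have sp: "space (uniform_count_measure ?P) = ?P" by (simp add: space_uniform_count_measure)
  have "(\<lambda>(Y, \<sigma>). jth_nearest j k s Y \<sigma>) \<in> samples k \<Otimes>\<^sub>M count_space ?P \<rightarrow>\<^sub>M borel"
    using measurable_compose_countable'[where I="?P" and g=snd and M="samples k \<Otimes>\<^sub>M count_space ?P"
        and N=borel and f="\<lambda>\<sigma> p. jth_nearest j k s (fst p) \<sigma>"]
      measurable_compose[OF measurable_fst sect(1)] fin
    by (auto simp: case_prod_unfold countable_finite)
  moreover have "sets (samples k \<Otimes>\<^sub>M uniform_count_measure ?P) = sets (samples k \<Otimes>\<^sub>M count_space ?P)"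
    by (intro sets_pair_measure_cong) (auto simp: sets_uniform_count_measure)
  ultimately have "(\<lambda>(Y, \<sigma>). jth_nearest j k s Y \<sigma>) \<in> samples k \<Otimes>\<^sub>M uniform_count_measure ?P \<rightarrow>\<^sub>M borel"
    by (simp cong: measurable_cong_sets)
  then show ?thesis
    unfolding nearest_kernel_def
  proof (rule distr_pair_measure_eq_of_sections[OF prob_space_samples prob_space_uniform_count_measure[OF fin ne]])
    fix \<sigma> assume "\<sigma> \<in> space (uniform_count_measure ?P)"
    then show "distr (samples k) borel (\<lambda>Y. case (Y, \<sigma>) of (Y, \<sigma>) \<Rightarrow> jth_nearest j k s Y \<sigma>)
        = distr (samples k) borel (\<lambda>Y. jth_nearest j k s Y id)"
      unfolding prod.case sp by (rule sect(2))
  qed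
qed

lemma measurable_nearest_kernel: "nearest_kernel \<theta> j k \<in> borel \<rightarrow>\<^sub>M prob_algebra borel"
proof (rule measurable_prob_algebraI)
  have m: "(\<lambda>Y. jth_nearest j k s Y id) \<in> samples k \<rightarrow>\<^sub>M borel" for s
    by (intro measurable_jth_nearest) auto
  show "prob_space (nearest_kernel \<theta> j k s)" for s
    unfolding nearest_kernel_eq using prob_space_samples m by (rule prob_space.prob_space_distr)
  show "nearest_kernel \<theta> j k \<in> borel \<rightarrow>\<^sub>M subprob_algebra borel"
    unfolding nearest_kernel_eq[abs_def]
  proof (rule measurable_distr2[where M="samples k"])
    show "(\<lambda>(s, Y). jth_nearest j k s Y id) \<in> borel \<Otimes>\<^sub>M samples k \<rightarrow>\<^sub>M borel"
      unfolding case_prod_unfold by (intro measurable_jth_nearest) auto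
    show "(\<lambda>_. samples k) \<in> borel \<rightarrow>\<^sub>M subprob_algebra (samples k)"
      using prob_space.M_in_subprob[OF prob_space_samples] by simp
  qed
qed

text \<open>
  The selected point is one of the \<open>k\<close> samples; hence this union bound, and the lower bound in
  \<open>measure_nearest_kernel_ge\<close> from the event that all samples fall into \<open>A\<close>.
\<close>
lemma measure_nearest_kernel_le:
  assumes "A \<in> sets borel"
  shows "measure (nearest_kernel \<theta> j k s) A \<le> real k * measure \<theta> A"
proof -
  interpret prob_space "samples k" by (rule prob_space_samples)
  have m: "(\<lambda>Y. jth_nearest j k s Y id) \<in> samples k \<rightarrow>\<^sub>M borel"
    by (intro measurable_jth_nearest) auto
  have c: "(\<lambda>Y. Y i) \<in> samples k \<rightarrow>\<^sub>M \<theta>" if "i < k" for i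
    using that by (intro measurable_component_singleton) auto
  have "measure (nearest_kernel \<theta> j k s) A = prob ((\<lambda>Y. jth_nearest j k s Y id) -` A \<inter> space (samples k))"
    unfolding nearest_kernel_eq by (rule measure_distr[OF m assms])
  also have "\<dots> \<le> prob (\<Union>i\<in>{..<k}. (\<lambda>Y. Y i) -` A \<inter> space (samples k))"
  proof (rule finite_measure_mono)
    show "(\<lambda>Y. jth_nearest j k s Y id) -` A \<inter> space (samples k) \<subseteq> (\<Union>i\<in>{..<k}. (\<lambda>Y. Y i) -` A \<inter> space (samples k))"
    proof
      fix Y assume Y: "Y \<in> (\<lambda>Y. jth_nearest j k s Y id) -` A \<inter> space (samples k)"
      obtain i where "i < k" "rank_within s Y {..<k} i = j" using ex1_rank[of s Y] by auto
      then show "Y \<in> (\<Union>i\<in>{..<k}. (\<lambda>Y. Y i) -` A \<inter> space (samples k))"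
        using Y jth_nearest_id_eq[of i s Y] by auto
    qed
  qed (use assms c sets_\<theta> in \<open>auto intro!: sets.finite_UN measurable_sets\<close>)
  also have "\<dots> \<le> (\<Sum>i<k. prob ((\<lambda>Y. Y i) -` A \<inter> space (samples k)))"
    by (intro finite_measure_subadditive_finite) (use assms c sets_\<theta> in \<open>auto intro!: measurable_sets\<close>)
  also have "\<dots> = (\<Sum>i<k. measure \<theta> A)"
  proof (rule sum.cong)
    fix i assume "i \<in> {..<k}"
    then have i: "i < k" by simp
    have "prob ((\<lambda>Y. Y i) -` A \<inter> space (samples k)) = measure (distr (samples k) \<theta> (\<lambda>Y. Y i)) A"
      using c[OF i] assms sets_\<theta> by (subst measure_distr) auto
    then show "prob ((\<lambda>Y. Y i) -` A \<inter> space (samples k)) = measure \<theta> A"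
      using distr_PiM_component[of "{..<k}" "\<lambda>_. \<theta>" i] prob_space_\<theta> i by simp
  qed simp
  finally show ?thesis by simp
qed

lemma measure_nearest_kernel_ge:
  assumes "A \<in> sets borel"
  shows "measure \<theta> A ^ k \<le> measure (nearest_kernel \<theta> j k s) A"
proof -
  interpret prob_space "samples k" by (rule prob_space_samples)
  interpret \<theta>: prob_space \<theta> by (rule prob_space_\<theta>)
  interpret P: product_sigma_finite "\<lambda>_::nat. \<theta>" ..
  have m: "(\<lambda>Y. jth_nearest j k s Y id) \<in> samples k \<rightarrow>\<^sub>M borel"
    by (intro measurable_jth_nearest) auto
  have "emeasure (samples k) (Pi\<^sub>E {..<k} (\<lambda>_. A)) = (\<Prod>i<k. emeasure \<theta> A)"
    using assms sets_\<theta> by (intro P.emeasure_PiM) auto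
  then have "measure \<theta> A ^ k = prob (Pi\<^sub>E {..<k} (\<lambda>_. A))"
    by (simp add: \<theta>.emeasure_eq_measure emeasure_eq_measure ennreal_power)
  also have "\<dots> \<le> prob ((\<lambda>Y. jth_nearest j k s Y id) -` A \<inter> space (samples k))"
  proof (rule finite_measure_mono)
    show "Pi\<^sub>E {..<k} (\<lambda>_. A) \<subseteq> (\<lambda>Y. jth_nearest j k s Y id) -` A \<inter> space (samples k)"
    proof
      fix Y assume Y: "Y \<in> Pi\<^sub>E {..<k} (\<lambda>_. A)"
      obtain i where "i < k" "rank_within s Y {..<k} i = j" using ex1_rank[of s Y] by auto
      then show "Y \<in> (\<lambda>Y. jth_nearest j k s Y id) -` A \<inter> space (samples k)"
        using Y jth_nearest_id_eq[of i s Y] by (auto simp: space_PiM space_\<theta>)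
    qed
  qed (use assms in \<open>auto intro: measurable_sets[OF m]\<close>)
  also have "\<dots> = measure (nearest_kernel \<theta> j k s) A"
    unfolding nearest_kernel_eq by (rule measure_distr[OF m assms, symmetric])
  finally show ?thesis .
qed

section \<open>Overlap of two transitions from a common pool of samples\<close>

text \<open>
  The enumeration is increasing, so that breaking ties by index means the same in the subsample as in
  the pool.
\<close>
definition subsample :: "nat set \<Rightarrow> (nat \<Rightarrow> 'a) \<Rightarrow> nat \<Rightarrow> 'a" where
  "subsample B Z = (\<lambda>l\<in>{..<k}. Z (enumerate B l))"

lemma subsample_law:
  assumes "B \<subseteq> {..<n}" "card B = k"
  shows "subsample B \<in> samples n \<rightarrow>\<^sub>M samples k"
    and "distr (samples n) (samples k) (subsample B) = samples k"
proof -
  have fin: "finite B" using assms by (auto intro: finite_subset)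
  have e: "inj_on (enumerate B) {..<k}" "enumerate B \<in> {..<k} \<rightarrow> {..<n}"
    using finite_bij_enumerate[OF fin] assms by (auto simp: bij_betw_def)
  show "subsample B \<in> samples n \<rightarrow>\<^sub>M samples k"
    unfolding subsample_def[abs_def] using e
    by (intro measurable_restrict measurable_component_singleton) auto
  show "distr (samples n) (samples k) (subsample B) = samples k"
    unfolding subsample_def[abs_def]
    using distr_PiM_reindex[OF _ e, of "\<lambda>_. \<theta>"] prob_space_\<theta> by simp
qed

lemma jth_nearest_subsample:
  assumes "finite B" "card B = k" "i \<in> B" "rank_within s Z B i = j"
  shows "jth_nearest j k s (subsample B Z) id = Z i"
proof (rule jth_nearest_eq)
  have b: "bij_betw (enumerate B) {..<k} B"
    using finite_bij_enumerate[OF assms(1)] assms(2) by simp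
  show "inj_on (enumerate B) {..<k}" using b by (rule bij_betw_imp_inj_on)
  have "enumerate B ` {..<k} = B" using b by (rule bij_betw_imp_surj_on)
  then show "i \<in> enumerate B ` {..<k}" "rank_within s Z (enumerate B ` {..<k}) i = j"
    using assms by simp_all
  show "id l \<le> id m \<longleftrightarrow> enumerate B l \<le> enumerate B m" if "l < k" "m < k" for l m
    using finite_enumerate_mono_iff[OF assms(1), of m l] that assms(2)
    by (simp flip: not_less)
qed (simp add: subsample_def)

text \<open>
  The transition can be made by drawing a pool of \<open>n\<close> samples and choosing a \<open>k\<close>-subset \<open>B\<close> of it
  in an arbitrary fixed way; averaging over all choices of \<open>B\<close>, the chain moves to the \<open>j\<close>'th
  nearest point of a uniformly random \<open>k\<close>-subset. Whatever pool is drawn, some \<open>k\<close>-subset selects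
  the index \<open>g Z\<close>, so that index is selected with conditional probability at least
  \<open>1 / (n choose k)\<close>.
\<close>
lemma middle_rank_law_le_kernel:
  assumes g: "g \<in> samples n \<rightarrow>\<^sub>M count_space {..<n}"
    and mid: "\<And>Z. j \<le> rank_within s Z {..<n} (g Z)"
      "\<And>Z. rank_within s Z {..<n} (g Z) + (k - j) \<le> n"
    and n: "k \<le> n"
  shows "scale_measure (ennreal (1 / (n choose k))) (distr (samples n) borel (\<lambda>Z. Z (g Z)))
    \<le> nearest_kernel \<theta> j k s"
proof -
  let ?\<B> = "{B. B \<subseteq> {..<n} \<and> card B = k}"
  let ?C = "n choose k"
  have C: "?C > 0" using n by simp
  have finB: "finite ?\<B>" by (rule finite_subset[of _ "Pow {..<n}"]) auto
  have m: "(\<lambda>Y. jth_nearest j k s Y id) \<in> samples k \<rightarrow>\<^sub>M borel"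
    by (intro measurable_jth_nearest) auto
  have gm: "(\<lambda>Z. Z (g Z)) \<in> samples n \<rightarrow>\<^sub>M borel"
    using measurable_selected_sample[of "\<lambda>Z. Z" "samples n" n g] g by simp
  have "emeasure (scale_measure (ennreal (1 / ?C)) (distr (samples n) borel (\<lambda>Z. Z (g Z)))) A
      \<le> emeasure (nearest_kernel \<theta> j k s) A" if A: "A \<in> sets borel" for A
  proof -
    define E where "E B = (\<lambda>Z. jth_nearest j k s (subsample B Z) id) -` A \<inter> space (samples n)" for B
    have mB: "(\<lambda>Z. jth_nearest j k s (subsample B Z) id) \<in> samples n \<rightarrow>\<^sub>M borel" if "B \<in> ?\<B>" for B
      using subsample_law(1)[of B n] that by (intro measurable_compose[OF _ m]) auto
    have E: "E B \<in> sets (samples n)" if "B \<in> ?\<B>" for B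
      unfolding E_def using mB[OF that] A by (rule measurable_sets)
    have EB: "emeasure (samples n) (E B) = emeasure (nearest_kernel \<theta> j k s) A" if "B \<in> ?\<B>" for B
    proof -
      have B: "B \<subseteq> {..<n}" "card B = k" using that by auto
      have "nearest_kernel \<theta> j k s = distr (distr (samples n) (samples k) (subsample B)) borel (\<lambda>Y. jth_nearest j k s Y id)"
        unfolding nearest_kernel_eq subsample_law(2)[OF B] ..
      also have "\<dots> = distr (samples n) borel (\<lambda>Z. jth_nearest j k s (subsample B Z) id)"
        using distr_distr[OF m subsample_law(1)[OF B]] by (simp add: comp_def)
      finally show ?thesis
        unfolding E_def using emeasure_distr[OF mB[OF that] A] by simp
    qed
    have "emeasure (distr (samples n) borel (\<lambda>Z. Z (g Z))) A
        = emeasure (samples n) ((\<lambda>Z. Z (g Z)) -` A \<inter> space (samples n))"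
      using gm A by (rule emeasure_distr)
    also have "\<dots> \<le> emeasure (samples n) (\<Union>B\<in>?\<B>. E B)"
    proof (rule emeasure_mono)
      show "(\<lambda>Z. Z (g Z)) -` A \<inter> space (samples n) \<subseteq> (\<Union>B\<in>?\<B>. E B)"
      proof
        fix Z assume Z: "Z \<in> (\<lambda>Z. Z (g Z)) -` A \<inter> space (samples n)"
        then have "g Z \<in> {..<n}" using measurable_space[OF g] by auto
        then obtain B where B: "B \<subseteq> {..<n}" "card B = k" "g Z \<in> B" "rank_within s Z B (g Z) = j"
          using ex_subset_with_rank[of "{..<n}" "g Z" j k s Z] mid[of Z] j_ge j_le by auto
        moreover have "finite B" using B by (auto intro: finite_subset)
        ultimately show "Z \<in> (\<Union>B\<in>?\<B>. E B)"
          using Z jth_nearest_subsample[of B "g Z" s Z] unfolding E_def by auto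
      qed
    qed (use E finB in \<open>auto intro!: sets.finite_UN\<close>)
    also have "\<dots> \<le> (\<Sum>B\<in>?\<B>. emeasure (samples n) (E B))"
      using E by (intro emeasure_subadditive_finite[OF finB]) (rule image_subsetI)
    also have "\<dots> = of_nat ?C * emeasure (nearest_kernel \<theta> j k s) A"
      using n_subsets[of "{..<n}" k] sum.cong[OF refl EB, of ?\<B> "\<lambda>B. B"] by simp
    finally have "ennreal (1 / ?C) * emeasure (distr (samples n) borel (\<lambda>Z. Z (g Z))) A
        \<le> ennreal (1 / ?C) * (of_nat ?C * emeasure (nearest_kernel \<theta> j k s) A)"
      by (rule mult_left_mono) simp
    also have "\<dots> = ennreal (1 / ?C * ?C) * emeasure (nearest_kernel \<theta> j k s) A"
      by (subst ennreal_mult) (auto simp: mult.assoc ennreal_of_nat_eq_real_of_nat)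
    also have "1 / ?C * ?C = (1 :: real)" using C by simp
    finally show ?thesis by simp
  qed
  then show ?thesis by (subst le_measure) (auto simp: nearest_kernel_def)
qed

text \<open>
  Two chains use the same pool of \<open>2 * k - 1\<close> samples. The least index that is in the middle of
  both orders is a possible destination for both.
\<close>
lemma kernel_overlap:
  "\<exists>\<eta>. sets \<eta> = sets borel \<and> \<eta> \<le> nearest_kernel \<theta> j k s \<and> \<eta> \<le> nearest_kernel \<theta> j k s' \<and>
     1 / ((2 * k - 1) choose k) \<le> measure \<eta> (space borel)"
proof -
  define n where "n = 2 * k - 1"
  have n: "k \<le> n" using j_ge j_le unfolding n_def by auto
  define common where "common Z i \<longleftrightarrow> i < n \<and> rank_within s Z {..<n} i \<in> {j..j + k - 1} \<and>
      rank_within s' Z {..<n} i \<in> {j..j + k - 1}" for Z i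
  define g where "g Z = (LEAST i. common Z i)" for Z
  have g: "common Z (g Z)" for Z
    unfolding g_def
  proof (rule LeastI_ex)
    show "\<exists>i. common Z i"
      using ex_common_middle_rank[of "{..<n}" k j s Z s'] j_ge j_le
      by (simp add: common_def n_def Bex_def)
  qed
  have middle: "Measurable.pred (samples n) (\<lambda>Z. rank_within x Z {..<n} i \<in> {j..j + k - 1})"
    if "i < n" for x i
  proof -
    have "(\<lambda>Z. rank_within x Z {..<n} i) \<in> samples n \<rightarrow>\<^sub>M count_space UNIV"
      using that by (intro measurable_rank_within) auto
    from measurable_compose[OF this, of "\<lambda>r. r \<in> {j..j + k - 1}" "count_space UNIV"]
    show ?thesis by simp
  qed
  have "Measurable.pred (samples n) (\<lambda>Z. common Z i)" for i
  proof (cases "i < n")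
    case True
    then show ?thesis
      unfolding common_def by (intro pred_intros_logic middle) simp_all
  qed (simp add: common_def)
  then have "g \<in> samples n \<rightarrow>\<^sub>M count_space UNIV"
    unfolding g_def[abs_def] by (rule measurable_Least)
  then have gm: "g \<in> samples n \<rightarrow>\<^sub>M count_space {..<n}"
    using g by (auto simp: measurable_def common_def)
  have gm': "(\<lambda>Z. Z (g Z)) \<in> samples n \<rightarrow>\<^sub>M borel"
    using measurable_selected_sample[of "\<lambda>Z. Z" "samples n" n g] gm by simp
  interpret D: prob_space "distr (samples n) borel (\<lambda>Z. Z (g Z))"
    using prob_space_samples gm' by (rule prob_space.prob_space_distr)
  let ?\<eta> = "scale_measure (ennreal (1 / (n choose k))) (distr (samples n) borel (\<lambda>Z. Z (g Z)))"
  have range: "j \<le> r \<and> r + (k - j) \<le> n" if "r \<in> {j..j + k - 1}" for r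
  proof -
    have "j \<le> r" "r + 1 \<le> j + k" using that j_ge by auto
    then show ?thesis using j_le unfolding n_def by linarith
  qed
  have "?\<eta> \<le> nearest_kernel \<theta> j k s"
  proof (rule middle_rank_law_le_kernel[OF gm _ _ n])
    fix Z
    show "j \<le> rank_within s Z {..<n} (g Z)" "rank_within s Z {..<n} (g Z) + (k - j) \<le> n"
      using g[of Z] range[of "rank_within s Z {..<n} (g Z)"] unfolding common_def by blast+
  qed
  moreover have "?\<eta> \<le> nearest_kernel \<theta> j k s'"
  proof (rule middle_rank_law_le_kernel[OF gm _ _ n])
    fix Z
    show "j \<le> rank_within s' Z {..<n} (g Z)" "rank_within s' Z {..<n} (g Z) + (k - j) \<le> n"
      using g[of Z] range[of "rank_within s' Z {..<n} (g Z)"] unfolding common_def by blast+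
  qed
  moreover have "1 / (n choose k) \<le> measure ?\<eta> (space borel)"
    using D.emeasure_space_1 by (simp add: measure_def)
  moreover have "sets ?\<eta> = sets borel" by simp
  ultimately show ?thesis
    unfolding n_def[symmetric] by (intro exI[of _ ?\<eta>] conjI)
qed

end

section \<open>The rate of convergence\<close>

lemma central_binomial_le:
  assumes "k \<ge> 1"
  shows "(2 * k - 1) choose k \<le> 4 ^ (k - 1)"
proof -
  have "((2 * k - 1) choose (k - 1)) + ((2 * k - 1) choose k) = (\<Sum>i\<in>{k - 1, k}. (2 * k - 1) choose i)"
    using assms by simp
  also have "\<dots> \<le> (\<Sum>i\<le>2 * k - 1. (2 * k - 1) choose i)"
    using assms by (intro sum_mono2) auto
  also have "\<dots> = 2 ^ (2 * k - 1)" by (rule choose_row_sum)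
  also have "\<dots> = 2 * 4 ^ (k - 1)"
    using assms power_mult[of "2::nat" 2 "k - 1"] by (cases k) auto
  finally have "((2 * k - 1) choose (k - 1)) + ((2 * k - 1) choose k) \<le> 2 * 4 ^ (k - 1)" .
  moreover have "(2 * k - 1) choose (k - 1) = (2 * k - 1) choose k"
    using assms binomial_symmetric[of "k" "2 * k - 1"] by (simp add: algebra_simps)
  ultimately show ?thesis by simp
qed

text \<open>
  For \<open>k \<ge> 4\<close> already \<open>c \<ge> 4 powr (1 - k) \<ge> k powr (1 - k)\<close>, that is, one step would do. For \<open>k = 2\<close>
  and \<open>k = 3\<close>, where \<open>c\<close> is \<open>1 / 3\<close> and \<open>1 / 10\<close>, the bound uses both steps.
\<close>
lemma two_step_rate_le:
  fixes k :: nat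
  assumes "k \<ge> 2"
  defines "c \<equiv> 1 / real ((2 * k - 1) choose k)"
  shows "(1 - c)\<^sup>2 \<le> 1 - 1 / real k ^ (k - 1)"
proof -
  consider "k = 2" | "k = 3" | "k \<ge> 4" using assms(1) by linarith
  then show ?thesis
  proof cases
    case 1
    then have "c = 1 / 3" unfolding c_def by (simp add: eval_nat_numeral)
    then show ?thesis using 1 by (simp only: \<open>c = 1 / 3\<close>) (simp add: power2_eq_square)
  next
    case 2
    then have "c = 1 / 10" unfolding c_def by (simp add: eval_nat_numeral)
    then show ?thesis using 2 by (simp only: \<open>c = 1 / 10\<close>) (simp add: power2_eq_square)
  next
    case 3
    have "(2 * k - 1) choose k \<le> 4 ^ (k - 1)" using 3 by (intro central_binomial_le) auto
    also have "\<dots> \<le> k ^ (k - 1)" using 3 by (intro power_mono) auto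
    finally have "real ((2 * k - 1) choose k) \<le> real k ^ (k - 1)"
      by (metis of_nat_le_iff of_nat_power)
    moreover have pos: "(2 * k - 1) choose k \<ge> 1" using 3 by (simp add: Suc_le_eq)
    ultimately have le: "1 / real k ^ (k - 1) \<le> c"
      unfolding c_def by (intro divide_left_mono mult_pos_pos) auto
    have "0 \<le> c" "c \<le> 1" unfolding c_def using pos by auto
    then have "(1 - c) * (1 - c) \<le> (1 - c) * 1" by (intro mult_left_mono) auto
    then show ?thesis using le by (simp add: power2_eq_square)
  qed
qed

section \<open>The stationary distribution of the nearest-sample chain\<close>

theorem theorem1:
  fixes \<theta> :: "'a::metric_space measure" and j k :: nat
  assumes "compact (UNIV :: 'a set)"
    and "prob_space \<theta>" and "sets \<theta> = sets borel"
    and "k \<ge> 2" and "1 \<le> j" and "j \<le> k"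
  shows "(\<exists>!\<pi>. stationary_distribution \<theta> j k \<pi>) \<and>
    (\<forall>\<pi>. stationary_distribution \<theta> j k \<pi> \<longrightarrow>
      (\<forall>x. \<forall>t\<ge>1. variation_distance \<pi> (chain_law \<theta> j k x (2 * t))
                    \<le> (1 - 1 / real k ^ (k - 1)) ^ t) \<and>
      (\<forall>x. (\<lambda>t. variation_distance \<pi> (chain_law \<theta> j k x t)) \<longlonglongrightarrow> 0) \<and>
      (\<forall>A\<in>sets borel. measure \<theta> A ^ k \<le> measure \<pi> A \<and>
                        measure \<pi> A \<le> real k * measure \<theta> A) \<and>
      absolutely_continuous \<theta> \<pi> \<and> absolutely_continuous \<pi> \<theta>)"
proof -
  interpret nearest_chain \<theta> j k
    using assms by (intro nearest_chain.intro)
  define c where "c = 1 / real ((2 * k - 1) choose k)"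
  have "(2 * k - 1) choose k \<ge> 1" using assms(4) by (simp add: Suc_le_eq)
  then have c: "0 < c" "c \<le> 1" unfolding c_def by auto
  interpret chain: overlapping_kernel borel "nearest_kernel \<theta> j k" c
    using measurable_nearest_kernel c kernel_overlap unfolding c_def
    by unfold_locales auto
  have law: "chain_law \<theta> j k x t = chain.law t x" for x t
    by (induction t) (simp_all add: chain.law_0 chain.law_Suc)
  have stat: "stationary_distribution \<theta> j k = chain.stationary"
    by (auto simp: fun_eq_iff stationary_distribution_def chain.stationary_def space_prob_algebra)
  have dist_le: "variation_distance \<pi> (chain_law \<theta> j k x t) \<le> (1 - c) ^ t"
    and dist_ge: "0 \<le> variation_distance \<pi> (chain_law \<theta> j k x t)"
    if "chain.stationary \<pi>" for \<pi> x t
  proof -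
    have close: "\<bar>measure \<pi> A - measure (chain_law \<theta> j k x t) A\<bar> \<le> (1 - c) ^ t"
      if "A \<in> sets borel" for A
      using chain.stationary_close[OF \<open>chain.stationary \<pi>\<close> _ that, of x t] by (simp add: law)
    then show "variation_distance \<pi> (chain_law \<theta> j k x t) \<le> (1 - c) ^ t"
      unfolding variation_distance_def by (intro cSUP_least) auto
    show "0 \<le> variation_distance \<pi> (chain_law \<theta> j k x t)"
      unfolding variation_distance_def
      using cSUP_upper[of "{}" "sets borel" "\<lambda>A. \<bar>measure \<pi> A - measure (chain_law \<theta> j k x t) A\<bar>"] close
      by (fastforce intro: bdd_aboveI2)
  qed
  have main: "(\<forall>x. \<forall>t\<ge>1. variation_distance \<pi> (chain_law \<theta> j k x (2 * t))
                    \<le> (1 - 1 / real k ^ (k - 1)) ^ t) \<and>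
      (\<forall>x. (\<lambda>t. variation_distance \<pi> (chain_law \<theta> j k x t)) \<longlonglongrightarrow> 0) \<and>
      (\<forall>A\<in>sets borel. measure \<theta> A ^ k \<le> measure \<pi> A \<and>
                        measure \<pi> A \<le> real k * measure \<theta> A) \<and>
      absolutely_continuous \<theta> \<pi> \<and> absolutely_continuous \<pi> \<theta>"
    if \<pi>: "chain.stationary \<pi>" for \<pi>
  proof (intro conjI allI impI ballI)
    fix x t
    have "variation_distance \<pi> (chain_law \<theta> j k x (2 * t)) \<le> ((1 - c)\<^sup>2) ^ t"
      using dist_le[OF \<pi>, of x "2 * t"] by (simp add: power_mult)
    also have "\<dots> \<le> (1 - 1 / real k ^ (k - 1)) ^ t"
      using two_step_rate_le[OF assms(4)] unfolding c_def by (intro power_mono) auto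
    finally show "variation_distance \<pi> (chain_law \<theta> j k x (2 * t)) \<le> (1 - 1 / real k ^ (k - 1)) ^ t" .
  next
    fix x
    show "(\<lambda>t. variation_distance \<pi> (chain_law \<theta> j k x t)) \<longlonglongrightarrow> 0"
      by (rule tendsto_sandwich[OF _ _ tendsto_const chain.rate_tendsto_0])
        (use dist_le[OF \<pi>] dist_ge[OF \<pi>] in auto)
  next
    interpret \<pi>: prob_space \<pi>
      using \<pi> by (simp add: chain.stationary_def space_prob_algebra)
    interpret \<theta>: prob_space \<theta> by (rule prob_space_\<theta>)
    have s: "sets \<pi> = sets borel" "space \<pi> = UNIV"
      using \<pi> by (auto simp: chain.stationary_def space_prob_algebra dest: sets_eq_imp_space_eq)
    have mean: "measure \<pi> A = (\<integral>x. measure (nearest_kernel \<theta> j k x) A \<partial>\<pi>)"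
      and int: "integrable \<pi> (\<lambda>x. measure (nearest_kernel \<theta> j k x) A)" if A: "A \<in> sets borel" for A
    proof -
      note [measurable_cong] = s(1)
      have K[measurable]: "nearest_kernel \<theta> j k \<in> \<pi> \<rightarrow>\<^sub>M prob_algebra borel"
        using measurable_nearest_kernel s(1) by (simp cong: measurable_cong_sets)
      have "measure (\<pi> \<bind> nearest_kernel \<theta> j k) A = (\<integral>x. measure (nearest_kernel \<theta> j k x) A \<partial>\<pi>)"
        using measurable_prob_algebraD[OF K] A by (rule \<pi>.measure_bind)
      then show "measure \<pi> A = (\<integral>x. measure (nearest_kernel \<theta> j k x) A \<partial>\<pi>)"
        using \<pi> by (simp add: chain.stationary_def)
      have "prob_space (nearest_kernel \<theta> j k x)" for x
        using measurable_space[OF measurable_nearest_kernel, of x] by (simp add: space_prob_algebra)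
      then show "integrable \<pi> (\<lambda>x. measure (nearest_kernel \<theta> j k x) A)"
        using A by (intro \<pi>.integrable_const_bound[of _ 1]) (auto simp: prob_space.prob_le_1)
    qed
    have lower: "measure \<theta> A ^ k \<le> measure \<pi> A" if "A \<in> sets borel" for A
      using \<pi>.integral_ge_const[OF int[OF that], of "measure \<theta> A ^ k"]
        measure_nearest_kernel_ge[OF that] mean[OF that] by simp
    have upper: "measure \<pi> A \<le> real k * measure \<theta> A" if "A \<in> sets borel" for A
      using \<pi>.integral_le_const[OF int[OF that], of "real k * measure \<theta> A"]
        measure_nearest_kernel_le[OF that] mean[OF that] by simp
    show "measure \<theta> A ^ k \<le> measure \<pi> A" "measure \<pi> A \<le> real k * measure \<theta> A"
      if "A \<in> sets borel" for A using lower[OF that] upper[OF that] .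
    show "absolutely_continuous \<theta> \<pi>"
      unfolding absolutely_continuous_def
    proof
      fix A assume "A \<in> null_sets \<theta>"
      then have A: "A \<in> sets borel" "measure \<theta> A = 0"
        using sets_\<theta> by (auto simp: null_sets_def measure_def)
      then have "measure \<pi> A = 0" using upper[of A] measure_nonneg[of \<pi> A] by simp
      then show "A \<in> null_sets \<pi>" using A s by (simp add: null_sets_def \<pi>.emeasure_eq_measure)
    qed
    show "absolutely_continuous \<pi> \<theta>"
      unfolding absolutely_continuous_def
    proof
      fix A assume "A \<in> null_sets \<pi>"
      then have A: "A \<in> sets borel" "measure \<pi> A = 0"
        using s by (auto simp: null_sets_def measure_def)
      then have "measure \<theta> A ^ k \<le> 0" using lower[of A] by simp
      then have "measure \<theta> A = 0"
        using measure_nonneg[of \<theta> A] by (metis power_eq_0_iff zero_le_power order_antisym)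
      then show "A \<in> null_sets \<theta>" using A sets_\<theta> by (simp add: null_sets_def \<theta>.emeasure_eq_measure)
    qed
  qed
  show ?thesis
    unfolding stat using chain.ex_stationary chain.stationary_unique main by blast
qed

end
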